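(* Let $X$, $Y$ be Banach spaces over $\mathbb{K}$. (a) $u,z\in X\hat{\otimes}_\varepsilon Y$ satisfy $u\perp_B z$ if and only if $$0\in\operatorname{conv}\bigl(\{\lim(x_n^*\otimes y_n^* )(z)\colon x_n^*\otimes y_n^*\in B_{X^*}\otimes B_{Y^*}\ \forall n\in\mathbb{N},\ \lim(x_n^*\otimes y_n^* )(u)=\|u\|_\varepsilon\}\bigr).$$ (b) $u\in X\hat{\otimes}_\varepsilon Y$ is smooth if and only if the set $$\{\lim(x_n^*\otimes y_n^* )(z)\colon x_n^*\otimes y_n^*\in B_{X^*}\otimes B_{Y^*}\ \forall n\in\mathbb{N},\ \lim(x_n^*\otimes y_n^* )(u)=\|u\|_\varepsilon\}$$ is a singleton for every $z\in X\hat{\otimes}_\varepsilon Y$.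
   Context: $\mathbb{K}$ is $\mathbb{R}$ or $\mathbb{C}$. $B_{X^*},B_{Y^*}$ are the closed unit balls of the dual spaces. The injective tensor product $X\hat{\otimes}_\varepsilon Y$ is the completion of $X\otimes Y$ under the norm $\|u\|_\varepsilon=\sup\{|\sum_{i=1}^n x^*(x_i)y^*(y_i)|\colon x^*\in B_{X^*},\ y^*\in B_{Y^*}\}$, where $\sum_{i=1}^n x_i\otimes y_i$ is any representation of $u$. For $x^*\in X^*$, $y^*\in Y^*$, $x^*\otimes y^*$ is the bounded linear functional on $X\hat{\otimes}_\varepsilon Y$ determined by $(x^*\otimes y^* )(x\otimes y)=x^*(x)y^*(y)$, and $B_{X^*}\otimes B_{Y^*}=\{x^*\otimes y^*\colon x^*\in B_{X^*},\ y^*\in B_{Y^*}\}$. $x\perp_B y$ (Birkhoff-James orthogonality) means $\|x+\lambda y\|\geq\|x\|$ for all $\lambda\in\mathbb{K}$. A point $z$ of a Banach space $Z$ is smooth if $\{\phi\in Z^*\colon\|\phi\|=1,\ \phi(z)=\|z\|\}$ is a singleton. Writing $\lim a_n$ for a bounded scalar sequence means that the sequence is required to be convergent. $\operatorname{conv}$ is the convex hull.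
   Formalization: Part (b) is stated for X and Y both nonzero; if X or Y is {0}, the tensor product is {0}, every limit set is the singleton {0}, yet u = 0 has no norm-one support functional and is not smooth, so (b) fails there. *)

theory Defs
  imports "HOL-Analysis.Analysis"
begin

text \<open>
  The scalar field: a normed field that is isometrically isomorphic to either the reals or
  the complex numbers.
\<close>

class real_or_complex_field = real_normed_field +
  assumes real_or_complex:
    "\<exists>h :: 'a \<Rightarrow> complex.
       (\<forall>x y. h (x + y) = h x + h y) \<and> (\<forall>x y. h (x * y) = h x * h y) \<and>
       (\<forall>x. norm (h x) = norm x) \<and> (range h = \<real> \<or> range h = UNIV)"

instance real :: real_or_complex_field
  by standard (rule exI[of _ complex_of_real], auto simp: Reals_def)

instance complex :: real_or_complex_field
  by standard (rule exI[of _ "\<lambda>z. z"], auto)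

text \<open>
  The type class \<^class>\<open>banach\<close> provides completeness, the norm and the underlying real
  vector space; the scalar multiplication by the field is an explicit parameter extending
  the real one.
\<close>

locale banach_space_over = vector_space s
  for s :: "'k::real_or_complex_field \<Rightarrow> 'a::banach \<Rightarrow> 'a" +
  assumes norm_scale: "norm (s c x) = norm c * norm x"
    and scale_of_real: "s (of_real r) x = r *\<^sub>R x"

lemma banach_space_over_scaleR: "banach_space_over (scaleR :: real \<Rightarrow> 'a::banach \<Rightarrow> 'a)"
  by unfold_locales (auto simp: algebra_simps)

lemma banach_space_over_complex: "banach_space_over ((*) :: complex \<Rightarrow> complex \<Rightarrow> complex)"
  by unfold_locales (auto simp: algebra_simps norm_mult scaleR_conv_of_real)

definition dual_space :: "('k::real_or_complex_field \<Rightarrow> 'a::banach \<Rightarrow> 'a) \<Rightarrow> ('a \<Rightarrow> 'k) set"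
  where "dual_space s = {f. bounded_linear f \<and> (\<forall>c x. f (s c x) = c * f x)}"

definition dual_ball :: "('k::real_or_complex_field \<Rightarrow> 'a::banach \<Rightarrow> 'a) \<Rightarrow> ('a \<Rightarrow> 'k) set"
  where "dual_ball s = {f \<in> dual_space s. onorm f \<le> 1}"

definition bj_orthogonal ::
    "('k::real_or_complex_field \<Rightarrow> 'a::banach \<Rightarrow> 'a) \<Rightarrow> 'a \<Rightarrow> 'a \<Rightarrow> bool"
  where "bj_orthogonal s x y \<longleftrightarrow> (\<forall>c. norm (x + s c y) \<ge> norm x)"

definition smooth_point :: "('k::real_or_complex_field \<Rightarrow> 'a::banach \<Rightarrow> 'a) \<Rightarrow> 'a \<Rightarrow> bool"
  where "smooth_point s z \<longleftrightarrow>
    is_singleton {f \<in> dual_space s. onorm f = 1 \<and> f z = of_real (norm z)}"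

text \<open>
  The injective norm of the tensor \<open>x\<^sub>1 \<otimes> y\<^sub>1 + \<dots> + x\<^sub>n \<otimes> y\<^sub>n\<close>, given by the list of the pairs
  \<open>(x\<^sub>i, y\<^sub>i)\<close>.
\<close>

definition injective_norm ::
    "('k::real_or_complex_field \<Rightarrow> 'a::banach \<Rightarrow> 'a) \<Rightarrow> ('k \<Rightarrow> 'b::banach \<Rightarrow> 'b)
      \<Rightarrow> ('a \<times> 'b) list \<Rightarrow> real"
  where "injective_norm sX sY ps =
    Sup {norm (\<Sum>(x, y)\<leftarrow>ps. f x * g y) | f g. f \<in> dual_ball sX \<and> g \<in> dual_ball sY}"

text \<open>
  The Banach space \<open>Z\<close> with the map \<open>tens\<close> is the completion of the algebraic tensor product
  of \<open>X\<close> and \<open>Y\<close> under the injective norm. A linear map from the algebraic tensor product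
  to \<open>Z\<close> is the same as a bilinear map \<open>tens\<close>, with \<open>x\<^sub>1 \<otimes> y\<^sub>1 + \<dots> + x\<^sub>n \<otimes> y\<^sub>n\<close> being sent to
  \<open>tens x\<^sub>1 y\<^sub>1 + \<dots> + tens x\<^sub>n y\<^sub>n\<close>; the last two assumptions say that this linear map is
  isometric and has dense range. Completeness of \<open>Z\<close> is part of \<^class>\<open>banach\<close>. This
  determines \<open>(Z, tens)\<close> up to a unique isometric isomorphism.

  The completion is described in this way, and not built as a type, because a type cannot
  depend on the scalar multiplications \<open>sX\<close> and \<open>sY\<close>.
\<close>

locale injective_tensor_product =
  X: banach_space_over sX + Y: banach_space_over sY + Z: banach_space_over sZ
  for sX :: "'k::real_or_complex_field \<Rightarrow> 'a::banach \<Rightarrow> 'a"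
    and sY :: "'k \<Rightarrow> 'b::banach \<Rightarrow> 'b"
    and sZ :: "'k \<Rightarrow> 'c::banach \<Rightarrow> 'c" +
  fixes tens :: "'a \<Rightarrow> 'b \<Rightarrow> 'c"
  assumes linear_left: "Vector_Spaces.linear sX sZ (\<lambda>x. tens x y)"
    and linear_right: "Vector_Spaces.linear sY sZ (\<lambda>y. tens x y)"
    and norm_tensor: "norm (\<Sum>(x, y)\<leftarrow>ps. tens x y) = injective_norm sX sY ps"
    and dense_tensors: "closure (range (\<lambda>ps. \<Sum>(x, y)\<leftarrow>ps. tens x y)) = UNIV"
begin

definition tensor_functional :: "('a \<Rightarrow> 'k) \<Rightarrow> ('b \<Rightarrow> 'k) \<Rightarrow> 'c \<Rightarrow> 'k"
  where "tensor_functional f g =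
    (THE h. h \<in> dual_space sZ \<and> (\<forall>x y. h (tens x y) = f x * g y))"

definition dual_ball_tensors :: "('c \<Rightarrow> 'k) set"
  where "dual_ball_tensors = {tensor_functional f g | f g. f \<in> dual_ball sX \<and> g \<in> dual_ball sY}"

definition limit_set :: "'c \<Rightarrow> 'c \<Rightarrow> 'k set"
  where "limit_set u z =
    {l. \<exists>h :: nat \<Rightarrow> 'c \<Rightarrow> 'k. (\<forall>n. h n \<in> dual_ball_tensors) \<and>
          (\<lambda>n. h n u) \<longlonglongrightarrow> of_real (norm u) \<and> (\<lambda>n. h n z) \<longlonglongrightarrow> l}"

end

end

theory Submission
  imports Defs
begin

text \<open>
  Both parts hold in every Banach space \<open>Z\<close> with a set \<open>D\<close> of functionals in its dual ball such
  that the norm of \<open>z\<close> is the supremum of \<open>Re h(z)\<close> over \<open>h \<in> D\<close>. Let \<open>L(u, z)\<close> be the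
  compact set of limit values. Functionals in \<open>D\<close> that almost norm \<open>u + t z\<close>, with \<open>t \<rightarrow> 0+\<close>,
  produce an element of \<open>L(u, z)\<close> whose real part is at least the one-sided derivative of
  the norm at \<open>u\<close> in the direction \<open>z\<close>. Hence, if 0 is not in the hull of \<open>L(u, z)\<close>, a separating
  functional on the scalar field gives a direction \<open>c z\<close> in which the norm decreases; and if
  \<open>L(u, z)\<close> is a singleton for all \<open>z\<close>, then all support functionals at \<open>u\<close> agree. Conversely,
  by the Hahn--Banach theorem each element of \<open>L(u, z)\<close> is the value at \<open>z\<close> of a support functional
  at \<open>u\<close>. That theorem, obtained from minimal sublinear functionals, also yields the functionals
  \<open>f \<otimes> g\<close> on the tensor product, which form the norming set.
\<close>

section \<open>Sublinear functionals\<close>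

definition sublinear :: "('a::real_vector \<Rightarrow> real) \<Rightarrow> bool"
  where "sublinear p \<longleftrightarrow>
    (\<forall>x y. p (x + y) \<le> p x + p y) \<and> (\<forall>t x. t \<ge> 0 \<longrightarrow> p (t *\<^sub>R x) = t * p x)"

text \<open>The inequality for \<open>1 / t\<close> at \<open>t *\<^sub>R x\<close> gives the
  converse one, so the constructions below only have to check one direction.\<close>

lemma sublinearI:
  assumes "\<And>x y. p (x + y) \<le> p x + p y" "p 0 = 0"
    and "\<And>t x. t > 0 \<Longrightarrow> p (t *\<^sub>R x) \<le> t * p x"
  shows "sublinear p"
proof -
  have "p (t *\<^sub>R x) = t * p x" if "t > 0" for t x
  proof -
    have "p ((1 / t) *\<^sub>R (t *\<^sub>R x)) \<le> (1 / t) * p (t *\<^sub>R x)"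
      using that by (intro assms(3)) auto
    then have "t * p x \<le> p (t *\<^sub>R x)"
      using that by (simp add: field_simps)
    then show ?thesis
      using assms(3)[OF that, of x] by simp
  qed
  then have "p (t *\<^sub>R x) = t * p x" if "t \<ge> 0" for t x
    using that assms(2) by (cases "t = 0") auto
  then show ?thesis
    using assms(1) by (auto simp: sublinear_def)
qed

lemma sublinear_add: "sublinear p \<Longrightarrow> p (x + y) \<le> p x + p y"
  by (simp add: sublinear_def)

lemma sublinear_scaleR: "sublinear p \<Longrightarrow> t \<ge> 0 \<Longrightarrow> p (t *\<^sub>R x) = t * p x"
  by (simp add: sublinear_def)

lemma sublinear_zero: "sublinear p \<Longrightarrow> p 0 = 0"
  using sublinear_scaleR[of p 0 0] by simp

lemma sublinear_minus_le: "sublinear p \<Longrightarrow> - p (- x) \<le> p x"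
  using sublinear_add[of p x "- x"] sublinear_zero[of p] by simp

lemma sublinear_norm: "sublinear norm"
  by (simp add: sublinear_def norm_triangle_ineq)

text \<open>\<open>p' x\<close> is the infimum of \<open>p (x + w) - r\<close> over
  \<open>G\<close>. The cone properties of \<open>G\<close> make it sublinear, and
  \<open>r \<le> p w\<close> keeps it finite. The bound at \<open>- w\<close> forces every linear
  \<open>q\<close> below \<open>p'\<close> to satisfy \<open>r \<le> q w\<close>.\<close>

lemma sublinear_lower_cone:
  fixes p :: "'a::real_vector \<Rightarrow> real"
  assumes p: "sublinear p"
    and zero: "(0, 0) \<in> G"
    and add: "\<And>w r v s. (w, r) \<in> G \<Longrightarrow> (v, s) \<in> G \<Longrightarrow> (w + v, r + s) \<in> G"
    and scale: "\<And>t w r. t > 0 \<Longrightarrow> (w, r) \<in> G \<Longrightarrow> (t *\<^sub>R w, t * r) \<in> G"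
    and le: "\<And>w r. (w, r) \<in> G \<Longrightarrow> r \<le> p w"
  obtains p' where "sublinear p'" "\<And>x. p' x \<le> p x" "\<And>w r. (w, r) \<in> G \<Longrightarrow> p' (- w) \<le> - r"
proof -
  define S where "S x = {p (x + w) - r | w r. (w, r) \<in> G}" for x
  define p' where "p' x = Inf (S x)" for x
  have lower: "- p (- x) \<le> p (x + w) - r" if "(w, r) \<in> G" for x w r
    using sublinear_add[OF p, of "x + w" "- x"] le[OF that] by simp
  have bdd: "bdd_below (S x)" for x
    unfolding S_def by (rule bdd_belowI[of _ "- p (- x)"]) (use lower in blast)
  have ne: "S x \<noteq> {}" for x
    using zero by (auto simp: S_def)
  have p'_le: "p' x \<le> p (x + w) - r" if "(w, r) \<in> G" for x w r
    unfolding p'_def by (rule cInf_lower[OF _ bdd]) (use that in \<open>auto simp: S_def\<close>)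
  have le_p': "a \<le> p' x" if "\<And>w r. (w, r) \<in> G \<Longrightarrow> a \<le> p (x + w) - r" for a x
    unfolding p'_def by (rule cInf_greatest[OF ne]) (use that in \<open>auto simp: S_def\<close>)
  have "sublinear p'"
  proof (rule sublinearI)
    fix x y
    \<comment> \<open>The two infima are taken one after the other, first over \<open>(v, s)\<close>
      with \<open>(w, r)\<close> fixed.\<close>
    have "p' (x + y) - (p (x + w) - r) \<le> p' y" if "(w, r) \<in> G" for w r
    proof (rule le_p')
      fix v s assume "(v, s) \<in> G"
      then have "p' (x + y) \<le> p (x + y + (w + v)) - (r + s)"
        by (intro p'_le add that)
      also have "x + y + (w + v) = (x + w) + (y + v)"
        by simp
      finally show "p' (x + y) - (p (x + w) - r) \<le> p (y + v) - s"
        using sublinear_add[OF p, of "x + w" "y + v"] by simp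
    qed
    then have "p' (x + y) - p' y \<le> p' x"
      by (intro le_p') (fastforce simp: algebra_simps)
    then show "p' (x + y) \<le> p' x + p' y"
      by simp
  next
    show "p' 0 = 0"
      using p'_le[OF zero, of 0] le_p'[of 0 0] le sublinear_zero[OF p] by force
  next
    fix t :: real and x assume t: "t > 0"
    have "p' (t *\<^sub>R x) / t \<le> p' x"
    proof (rule le_p')
      fix w r assume "(w, r) \<in> G"
      then have "p' (t *\<^sub>R x) \<le> p (t *\<^sub>R x + t *\<^sub>R w) - t * r"
        by (intro p'_le scale t)
      also have "p (t *\<^sub>R x + t *\<^sub>R w) = t * p (x + w)"
        using sublinear_scaleR[OF p, of t "x + w"] t by (simp add: algebra_simps)
      finally show "p' (t *\<^sub>R x) / t \<le> p (x + w) - r"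
        using t by (simp add: field_simps)
    qed
    then show "p' (t *\<^sub>R x) \<le> t * p' x"
      using t by (simp add: field_simps)
  qed
  moreover have "p' x \<le> p x" for x
    using p'_le[OF zero, of x] by simp
  moreover have "p' (- w) \<le> - r" if "(w, r) \<in> G" for w r
    using p'_le[OF that, of "- w"] sublinear_zero[OF p] by simp
  ultimately show thesis
    by (rule that)
qed

lemma exists_minimal_sublinear:
  fixes p :: "'a::real_vector \<Rightarrow> real"
  assumes p: "sublinear p"
  obtains m where "sublinear m" "\<And>x. m x \<le> p x"
    "\<And>q. sublinear q \<Longrightarrow> (\<And>x. q x \<le> m x) \<Longrightarrow> q = m"
proof -
  define A where "A = {q. sublinear q \<and> (\<forall>x. q x \<le> p x)}"
  \<comment> \<open>The order is reversed, so that a maximal element in the sense of Zorn is a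
    minimal functional.\<close>
  define P where "P q q' \<longleftrightarrow> (\<forall>x. q' x \<le> (q x :: real))" for q q' :: "'a \<Rightarrow> real"
  have "\<exists>m\<in>A. \<forall>q\<in>A. P m q \<longrightarrow> q = m"
  proof (rule predicate_Zorn)
    show "partial_order_on A (relation_of P A)"
      unfolding P_def
      by (rule partial_order_on_relation_ofI) (auto intro: order_trans simp: order_antisym fun_eq_iff)
  next
    fix C assume "C \<in> Chains (relation_of P A)"
    then have sub: "q \<in> A" if "q \<in> C" for q
      using that by (auto simp: Chains_def relation_of_def)
    from \<open>C \<in> _\<close> have chain: "P q q' \<or> P q' q" if "q \<in> C" "q' \<in> C" for q q'
      using that by (auto simp: Chains_def relation_of_def)
    show "\<exists>m\<in>A. \<forall>q\<in>C. P q m"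
    proof (cases "C = {}")
      case True
      then show ?thesis
        using p by (auto simp: A_def)
    next
      case False
      define m where "m x = (INF q\<in>C. q x)" for x
      have bdd: "bdd_below ((\<lambda>q. q x) ` C)" for x
      proof (rule bdd_belowI2)
        fix q assume "q \<in> C"
        then have "sublinear q" "q (- x) \<le> p (- x)"
          using sub by (auto simp: A_def)
        then show "- p (- x) \<le> q x"
          using sublinear_minus_le[of q x] by simp
      qed
      have m_le: "m x \<le> q x" if "q \<in> C" for q x
        unfolding m_def by (rule cINF_lower[OF bdd that])
      have le_m: "a \<le> m x" if "\<And>q. q \<in> C \<Longrightarrow> a \<le> q x" for a x
        unfolding m_def by (rule cINF_greatest[OF False that])
      have sublin: "sublinear q" if "q \<in> C" for q
        using sub[OF that] by (simp add: A_def)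
      have "sublinear m"
      proof (rule sublinearI)
        fix x y
        \<comment> \<open>Members of a chain are comparable, and the smaller of the two can serve
          both summands.\<close>
        have *: "m (x + y) \<le> q x + q' y" if "q \<in> C" "q' \<in> C" for q q'
        proof (cases "P q q'")
          case True
          then have "q' x \<le> q x"
            by (simp add: P_def)
          then show ?thesis
            using m_le[OF that(2), of "x + y"] sublinear_add[OF sublin[OF that(2)], of x y] by simp
        next
          case False
          then have "q y \<le> q' y"
            using chain that by (auto simp: P_def)
          then show ?thesis
            using m_le[OF that(1), of "x + y"] sublinear_add[OF sublin[OF that(1)], of x y] by simp
        qed
        have "m (x + y) - q x \<le> m y" if "q \<in> C" for q
          by (rule le_m) (use *[OF that] in \<open>simp add: algebra_simps\<close>)
        then have "m (x + y) - m y \<le> m x"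
          by (intro le_m) (fastforce simp: algebra_simps)
        then show "m (x + y) \<le> m x + m y"
          by simp
      next
        show "m 0 = 0"
          using False sublinear_zero[OF sublin] le_m[of 0 0] m_le[of _ 0] by fastforce
      next
        fix t :: real and x assume t: "t > 0"
        have "m (t *\<^sub>R x) / t \<le> m x"
        proof (rule le_m)
          fix q assume "q \<in> C"
          then show "m (t *\<^sub>R x) / t \<le> q x"
            using m_le[of q "t *\<^sub>R x"] sublinear_scaleR[OF sublin, of q t x] t
            by (simp add: field_simps)
        qed
        then show "m (t *\<^sub>R x) \<le> t * m x"
          using t by (simp add: field_simps)
      qed
      moreover obtain q0 where "q0 \<in> C"
        using False by blast
      then have "m x \<le> p x" for x
        using m_le[of q0 x] sub[of q0] order_trans[of "m x" "q0 x" "p x"] by (simp add: A_def)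
      ultimately show ?thesis
        using m_le by (auto simp: A_def P_def)
    qed
  qed
  then obtain m where m: "m \<in> A" "\<And>q. q \<in> A \<Longrightarrow> P m q \<Longrightarrow> q = m"
    by blast
  show thesis
  proof (rule that)
    show "sublinear m" and m_le: "m x \<le> p x" for x
      using m(1) by (auto simp: A_def)
    show "q = m" if "sublinear q" "\<And>x. q x \<le> m x" for q
    proof (rule m(2))
      show "q \<in> A"
        using that m_le order_trans by (fastforce simp: A_def)
    qed (use that in \<open>simp add: P_def\<close>)
  qed
qed

text \<open>
  A minimal sublinear functional \<open>m\<close> cannot be lowered along the ray of \<open>y\<close>, which gives
  \<open>m (- y) = - m y\<close>.
\<close>

lemma exists_linear_below_sublinear:
  fixes p :: "'a::real_vector \<Rightarrow> real"
  assumes "sublinear p"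
  obtains q where "linear q" "\<And>x. q x \<le> p x"
proof -
  obtain m where m: "sublinear m" and m_le: "\<And>x. m x \<le> p x"
    and minimal: "\<And>q. sublinear q \<Longrightarrow> (\<And>x. q x \<le> m x) \<Longrightarrow> q = m"
    using exists_minimal_sublinear[OF assms] by blast
  have odd: "m (- y) = - m y" for y
  proof -
    define G where "G = {(t *\<^sub>R y, t * m y) | t. t \<ge> 0}"
    have G: "(t *\<^sub>R y, t * m y) \<in> G" if "t \<ge> 0" for t
      using that by (auto simp: G_def)
    obtain p' where p': "sublinear p'" "\<And>x. p' x \<le> m x" "\<And>w r. (w, r) \<in> G \<Longrightarrow> p' (- w) \<le> - r"
    proof (rule sublinear_lower_cone[OF m, of G])
      show "(0, 0) \<in> G"
        using G[of 0] by simp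
      show "(w + v, r + s) \<in> G" if wr: "(w, r) \<in> G" and vs: "(v, s) \<in> G" for w r v s
      proof -
        obtain a where "a \<ge> 0" "w = a *\<^sub>R y" "r = a * m y"
          using wr by (auto simp: G_def)
        moreover obtain b where "b \<ge> 0" "v = b *\<^sub>R y" "s = b * m y"
          using vs by (auto simp: G_def)
        ultimately show ?thesis
          using G[of "a + b"] by (simp add: algebra_simps)
      qed
      show "(t *\<^sub>R w, t * r) \<in> G" if t: "t > 0" and wr: "(w, r) \<in> G" for t w r
      proof -
        obtain a where "a \<ge> 0" "w = a *\<^sub>R y" "r = a * m y"
          using wr by (auto simp: G_def)
        then show ?thesis
          using G[of "t * a"] t by (simp add: algebra_simps)
      qed
      show "r \<le> m w" if "(w, r) \<in> G" for w r
        using that sublinear_scaleR[OF m] by (auto simp: G_def)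
    qed blast
    have "p' = m"
      using p'(1,2) by (rule minimal)
    then have "m (- y) \<le> - m y"
      using p'(3) G[of 1] by simp
    then show ?thesis
      using sublinear_minus_le[OF m, of y] by simp
  qed
  have "linear m"
  proof (rule linearI)
    fix x y
    \<comment> \<open>Oddness turns subadditivity into the reverse inequality.\<close>
    have "m x \<le> m (x + y) - m y"
      using sublinear_add[OF m, of "x + y" "- y"] odd[of y] by simp
    then show "m (x + y) = m x + m y"
      using sublinear_add[OF m, of x y] by simp
  next
    fix t x
    show "m (t *\<^sub>R x) = t *\<^sub>R m x"
    proof (cases "t \<ge> 0")
      case True
      then show ?thesis
        using sublinear_scaleR[OF m] by simp
    next
      case False
      then show ?thesis
        using sublinear_scaleR[OF m, of "- t" x] odd[of "t *\<^sub>R x"] by simp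
    qed
  qed
  then show thesis
    using m_le that by blast
qed

text \<open>The cone prescribes lower bounds instead of values; where it contains the negative of a
  pair as well, the two bounds amount to an equality.\<close>

lemma hahn_banach_cone:
  fixes p :: "'a::real_vector \<Rightarrow> real"
  assumes "sublinear p" "(0, 0) \<in> G"
    and "\<And>w r v s. (w, r) \<in> G \<Longrightarrow> (v, s) \<in> G \<Longrightarrow> (w + v, r + s) \<in> G"
    and "\<And>t w r. t > 0 \<Longrightarrow> (w, r) \<in> G \<Longrightarrow> (t *\<^sub>R w, t * r) \<in> G"
    and "\<And>w r. (w, r) \<in> G \<Longrightarrow> r \<le> p w"
  obtains q where "linear q" "\<And>x. q x \<le> p x" "\<And>w r. (w, r) \<in> G \<Longrightarrow> r \<le> q w"
proof -
  obtain p' where p': "sublinear p'" "\<And>x. p' x \<le> p x" "\<And>w r. (w, r) \<in> G \<Longrightarrow> p' (- w) \<le> - r"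
    using sublinear_lower_cone[OF assms] by blast
  obtain q where q: "linear q" "\<And>x. q x \<le> p' x"
    using exists_linear_below_sublinear[OF p'(1)] by blast
  show thesis
  proof (rule that[OF q(1)])
    show "q x \<le> p x" for x
      using q(2) p'(2) order_trans by blast
    show "r \<le> q w" if "(w, r) \<in> G" for w r
      using q(2)[of "- w"] p'(3)[OF that] linear_neg[OF q(1), of w] by simp
  qed
qed

section \<open>The scalar field\<close>

text \<open>A fixed choice of the embedding whose existence the class asserts; through it the real
  and the complex case are treated at once.\<close>

definition emb :: "'k::real_or_complex_field \<Rightarrow> complex"
  where "emb = (SOME h.
    (\<forall>x y. h (x + y) = h x + h y) \<and> (\<forall>x y. h (x * y) = h x * h y) \<and>
    (\<forall>x. norm (h x) = norm x) \<and> (range h = \<real> \<or> range h = UNIV))"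

lemma
  shows emb_add: "emb (x + y) = emb x + emb y"
    and emb_mult: "emb (x * y) = emb x * emb y"
    and norm_emb [simp]: "norm (emb x) = norm x"
    and range_emb: "range (emb :: 'k::real_or_complex_field \<Rightarrow> complex) = \<real>
      \<or> range (emb :: 'k \<Rightarrow> complex) = UNIV"
  using someI_ex[OF real_or_complex, folded emb_def] by blast+

lemma emb_diff: "emb (x - y) = emb x - emb y"
  using emb_add[of "x - y" y] by simp

lemma emb_uminus: "emb (- x) = - emb x"
  using emb_diff[of 0 x] emb_diff[of 0 0] by simp

lemma emb_inject: "emb x = emb y \<longleftrightarrow> x = y"
  using norm_emb[of "x - y"] by (auto simp: emb_diff)

lemma emb_one [simp]: "emb (1 :: 'k::real_or_complex_field) = 1"
proof -
  have "emb (1 :: 'k) * emb (1 :: 'k) = emb (1 :: 'k) * 1"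
    using emb_mult[of 1 "1 :: 'k"] by simp
  moreover have "emb (1 :: 'k) \<noteq> 0"
    using norm_emb[of "1 :: 'k"] by (metis norm_one norm_zero zero_neq_one)
  ultimately show ?thesis
    using mult_left_cancel by blast
qed

text \<open>The distances of a complex number to 0 and 1 determine it if they are those of a real number.\<close>

lemma emb_of_real [simp]: "emb (of_real r :: 'k::real_or_complex_field) = of_real r"
proof -
  define w where "w = emb (of_real r :: 'k)"
  have "norm w = \<bar>r\<bar>"
    by (simp add: w_def)
  then have 1: "(Re w)\<^sup>2 + (Im w)\<^sup>2 = r\<^sup>2"
    by (metis cmod_power2 power2_abs)
  have "norm (w - 1) = norm (of_real (r - 1) :: 'k)"
    using norm_emb[of "of_real r - 1 :: 'k"] by (simp add: w_def emb_diff)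
  then have "norm (w - 1) = \<bar>r - 1\<bar>"
    by (simp only: norm_of_real)
  then have "(Re w - 1)\<^sup>2 + (Im w)\<^sup>2 = (r - 1)\<^sup>2"
    by (metis cmod_power2 power2_abs minus_complex.simps one_complex.simps diff_zero)
  with 1 have "Re w = r"
    by (simp add: power2_eq_square algebra_simps)
  with 1 show ?thesis
    by (simp add: complex_eq_iff flip: w_def)
qed

lemma bounded_linear_emb: "bounded_linear emb"
  by (rule bounded_linear_intro[where K = 1])
    (simp_all add: emb_add emb_mult scaleR_conv_of_real)

text \<open>The embedding is isometric and its range is closed, so convergent subsequences can be
  pulled back from the complex numbers.\<close>

instance real_or_complex_field \<subseteq> heine_borel
proof
  fix f :: "nat \<Rightarrow> 'a"
  assume "bounded (range f)"
  then have "bounded (range (emb \<circ> f))"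
    by (simp add: bounded_iff)
  then obtain l r where r: "strict_mono (r :: nat \<Rightarrow> nat)" "((emb \<circ> f) \<circ> r) \<longlonglongrightarrow> l"
    using bounded_imp_convergent_subsequence by blast
  have "closed (range (emb :: 'a \<Rightarrow> complex))"
    using range_emb[where 'k = 'a] closed_complex_Reals by auto
  then have "l \<in> range (emb :: 'a \<Rightarrow> complex)"
    by (rule closed_sequentially[OF _ _ r(2)]) auto
  then obtain k :: 'a where k: "l = emb k"
    by blast
  have "(\<lambda>n. norm (emb (f (r n)) - emb k)) \<longlonglongrightarrow> 0"
    using r(2) k by (intro tendsto_norm_zero LIM_zero) (simp add: o_def)
  then have "(\<lambda>n. norm (f (r n) - k)) \<longlonglongrightarrow> 0"
    by (simp flip: emb_diff)
  then have "(f \<circ> r) \<longlonglongrightarrow> k"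
    by (simp add: o_def LIM_zero_iff tendsto_norm_zero_iff)
  with r(1) show "\<exists>l r. strict_mono (r :: nat \<Rightarrow> nat) \<and> (f \<circ> r) \<longlonglongrightarrow> l"
    by blast
qed

definition re :: "'k::real_or_complex_field \<Rightarrow> real"
  where "re x = Re (emb x)"

lemma bounded_linear_re: "bounded_linear re"
  unfolding re_def by (rule bounded_linear_compose[OF bounded_linear_Re bounded_linear_emb])

lemmas tendsto_re = bounded_linear.tendsto[OF bounded_linear_re]

lemma re_add: "re (x + y) = re x + re y"
  by (simp add: re_def emb_add)

lemma re_diff: "re (x - y) = re x - re y"
  by (simp add: re_def emb_diff)

lemma re_minus: "re (- x) = - re x"
  by (simp add: re_def emb_uminus)

lemma re_zero [simp]: "re 0 = 0"
  using re_diff[of 0 0] by simp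

lemma re_of_real [simp]: "re (of_real r) = r"
  by (simp add: re_def)

lemma re_one [simp]: "re 1 = 1"
  by (simp add: re_def)

lemma re_of_real_mult: "re (of_real r * x) = r * re x"
  by (simp add: re_def emb_mult)

lemma re_le_norm: "re x \<le> norm x"
  unfolding re_def using complex_Re_le_cmod[of "emb x"] by simp

text \<open>The unit \<open>j\<close> is 0 over the reals.\<close>

lemma imaginary_unit:
  obtains j :: "'k::real_or_complex_field"
  where "j = 0 \<or> j * j = - 1" "\<And>r. re (j * of_real r) = 0"
    "\<And>c. c = of_real (re c) + of_real (Im (emb c)) * j"
  using range_emb[where 'k = 'k]
proof
  assume "range (emb :: 'k \<Rightarrow> complex) = \<real>"
  then have "Im (emb c) = 0" for c :: 'k
    by (metis complex_is_Real_iff rangeI)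
  then have "c = of_real (re c)" for c :: 'k
    by (simp add: complex_eq_iff re_def flip: emb_inject[of c])
  then show thesis
    by (intro that[of 0]) auto
next
  assume "range (emb :: 'k \<Rightarrow> complex) = UNIV"
  then obtain j :: 'k where j: "emb j = \<i>"
    by (metis UNIV_I imageE)
  have "emb (j * j) = emb (- 1 :: 'k)"
    by (simp only: emb_mult emb_uminus emb_one j i_squared)
  moreover have "emb c = emb (of_real (re c) + of_real (Im (emb c)) * j)" for c :: 'k
    by (simp add: complex_eq_iff re_def emb_add emb_mult j)
  ultimately show thesis
    unfolding emb_inject by (intro that[of j] disjI2) (simp_all add: re_def emb_mult j)
qed

text \<open>If \<open>x\<close> and \<open>y\<close> differed, \<open>c = inverse (x - y)\<close>
  would make the two real parts differ by 1. This recovers a functional from its real part.\<close>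

lemma eq_if_re_mult_eq:
  fixes x y :: "'k::real_or_complex_field"
  assumes "\<And>c. re (c * x) = re (c * y)"
  shows "x = y"
proof (cases "x = y")
  case False
  then have "re (inverse (x - y) * x) - re (inverse (x - y) * y) = re (1 :: 'k)"
    by (simp add: right_diff_distrib[symmetric] flip: re_diff)
  then show ?thesis
    using assms by simp
qed simp

lemma unimodular_rotation:
  fixes x :: "'k::real_or_complex_field"
  obtains c :: 'k where "norm c = 1" "c * x = of_real (norm x)"
proof (cases "x = 0")
  case False
  then show thesis
    by (intro that[of "of_real (norm x) / x"]) (auto simp: norm_divide)
qed (auto intro: that[of 1])

text \<open>Turns the normal vector of a hyperplane in the complex plane into a scalar of the field:
  the conjugate of \<open>a\<close> in the complex case, its real part in the real case.\<close>

lemma inner_emb_eq_re: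
  obtains c :: "'k::real_or_complex_field" where "\<And>x. a \<bullet> emb x = re (c * x)"
  using range_emb[where 'k = 'k]
proof
  assume "range (emb :: 'k \<Rightarrow> complex) = \<real>"
  then have "Im (emb x) = 0" for x :: 'k
    by (metis complex_is_Real_iff rangeI)
  then show thesis
    by (intro that[of "of_real (Re a)"]) (simp add: re_def emb_mult inner_complex_def)
next
  assume "range (emb :: 'k \<Rightarrow> complex) = UNIV"
  then obtain c :: 'k where "emb c = cnj a"
    by (metis UNIV_I imageE)
  then show thesis
    by (intro that[of c]) (simp add: re_def emb_mult inner_complex_def)
qed

text \<open>The separation takes place in the complex plane. Compactness of \<open>L\<close> makes
  the hull of its image closed, which gives strict separation from 0.\<close>

lemma separation_from_zero:
  fixes L :: "'k::real_or_complex_field set"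
  assumes "compact L" "0 \<notin> convex hull L"
  obtains c where "\<And>l. l \<in> L \<Longrightarrow> re (c * l) < 0"
proof -
  have lin: "linear (emb :: 'k \<Rightarrow> complex)"
    by (rule bounded_linear.linear[OF bounded_linear_emb])
  have "compact (emb ` L)"
    by (rule compact_continuous_image[OF linear_continuous_on[OF bounded_linear_emb] assms(1)])
  then have "closed (convex hull (emb ` L))"
    by (intro compact_imp_closed compact_convex_hull)
  moreover have "0 \<notin> convex hull (emb ` L)"
  proof
    assume "0 \<in> convex hull (emb ` L)"
    then obtain x where "x \<in> convex hull L" "emb x = 0"
      unfolding convex_hull_linear_image[OF lin, symmetric] by (metis imageE)
    then show False
      using assms(2) norm_emb[of x] by simp
  qed
  ultimately obtain a b where ab: "0 < b" "\<And>x. x \<in> convex hull (emb ` L) \<Longrightarrow> b < a \<bullet> x"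
    using separating_hyperplane_closed_0[OF convex_convex_hull] by blast
  obtain c :: 'k where c: "\<And>x. a \<bullet> emb x = re (c * x)"
    using inner_emb_eq_re by blast
  \<comment> \<open>The hyperplane yields positive real parts; the sign is changed so that the
    scalar gives a direction of descent.\<close>
  have "re (- c * l) < 0" if "l \<in> L" for l
    using ab(2)[of "emb l"] ab(1) that c[of l] by (simp add: hull_inc re_minus)
  then show thesis
    by (rule that)
qed

section \<open>Functionals on Banach spaces over the scalar field\<close>

lemma dual_ball_norm_le: "f \<in> dual_ball s \<Longrightarrow> norm (f x) \<le> norm x"
  using onorm[of f x] mult_right_mono[of "onorm f" 1 "norm x"]
  by (auto simp: dual_ball_def dual_space_def)

lemma dual_ballI:
  assumes "bounded_linear f" "\<And>c x. f (s c x) = c * f x" "\<And>x. norm (f x) \<le> norm x"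
  shows "f \<in> dual_ball s"
  using assms onorm_bound[of 1 f] by (auto simp: dual_ball_def dual_space_def)

lemma dual_ball_bounded_linear: "f \<in> dual_ball s \<Longrightarrow> bounded_linear f"
  by (simp add: dual_ball_def dual_space_def)

lemma dual_ball_scale: "f \<in> dual_ball s \<Longrightarrow> f (s c x) = c * f x"
  by (simp add: dual_ball_def dual_space_def)

lemma dual_ball_add: "f \<in> dual_ball s \<Longrightarrow> f (x + y) = f x + f y"
  by (rule linear_add[OF bounded_linear.linear[OF dual_ball_bounded_linear]])

lemma dual_ball_zero: "(\<lambda>x. 0) \<in> dual_ball s"
  by (rule dual_ballI) auto

lemma dual_ball_mult:
  assumes "f \<in> dual_ball s" "norm c \<le> 1"
  shows "(\<lambda>x. c * f x) \<in> dual_ball s"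
proof (rule dual_ballI)
  show "bounded_linear (\<lambda>x. c * f x)"
    by (rule bounded_linear_const_mult[OF dual_ball_bounded_linear[OF assms(1)]])
  show "norm (c * f x) \<le> norm x" for x
    using mult_mono[OF assms(2) dual_ball_norm_le[OF assms(1), of x]] by (simp add: norm_mult)
qed (simp add: dual_ball_scale[OF assms(1)] mult.left_commute)

section \<open>The Hahn-Banach theorem over the scalar field\<close>

context banach_space_over
begin

text \<open>A functional over the field is recovered from its real part \<open>q\<close> by the
  formula \<open>q x - j q(j x)\<close>, which is \<open>q\<close> itself when
  \<open>j = 0\<close>.\<close>

lemma real_functional_extends:
  assumes q: "linear q" and le: "\<And>x. q x \<le> norm x"
  obtains f where "f \<in> dual_ball s" "\<And>x. re (f x) = q x"
proof -
  obtain j :: 'k where j: "j = 0 \<or> j * j = - 1" and re_j: "\<And>r. re (j * of_real r) = 0"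
    and decomp: "\<And>c. c = of_real (re c) + of_real (Im (emb c)) * j"
    using imaginary_unit by blast
  define f where "f x = of_real (q x) - j * of_real (q (s j x))" for x
  have qs: "q (s (of_real r) x) = r * q x" for r x
    by (simp add: scale_of_real linear_scale[OF q])
  have re_f: "re (f x) = q x" for x
    by (simp add: f_def re_diff re_j)
  have f_scale: "f (s c x) = c * f x" for c x
  proof -
    define a b where "a = re c" and "b = Im (emb c)"
    have c: "c = of_real a + of_real b * j"
      unfolding a_def b_def by (rule decomp)
    have 1: "q (s c x) = a * q x + b * q (s j x)"
    proof -
      have "s c x = s (of_real a) x + s (of_real b) (s j x)"
        by (simp add: c scale_left_distrib)
      then show ?thesis
        by (simp only: linear_add[OF q] qs)
    qed
    have 2: "q (s j (s c x)) = a * q (s j x) + b * q (s (j * j) x)"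
    proof -
      have "s j (s c x) = s (of_real a) (s j x) + s (of_real b) (s (j * j) x)"
        by (simp add: c scale_left_distrib scale_right_distrib algebra_simps)
      then show ?thesis
        by (simp only: linear_add[OF q] qs)
    qed
    from j show ?thesis
    proof
      assume "j = 0"
      then show ?thesis
        using 1 by (simp add: f_def c linear_0[OF q])
    next
      assume jj: "j * j = - 1"
      have "q (s (j * j) x) = - q x"
        by (simp add: jj linear_neg[OF q])
      then have "f (s c x) = of_real (a * q x + b * q (s j x)) - j * of_real (a * q (s j x) - b * q x)"
        unfolding f_def 1 2 \<open>q (s (j * j) x) = - q x\<close> by simp
      also have "\<dots> = of_real a * of_real (q x) + of_real b * of_real (q (s j x))
          - of_real a * j * of_real (q (s j x)) + of_real b * j * of_real (q x)"
        by (simp add: algebra_simps)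
      \<comment> \<open>Writing \<open>b\<close> as \<open>- b * (j * j)\<close> turns the four
        terms into the expansion of \<open>(a + b * j) * f x\<close>.\<close>
      also have "\<dots> = of_real a * of_real (q x) - of_real b * (j * j) * of_real (q (s j x))
          - of_real a * j * of_real (q (s j x)) + of_real b * j * of_real (q x)"
        by (simp add: jj)
      also have "\<dots> = c * f x"
        by (simp add: c f_def algebra_simps)
      finally show ?thesis .
    qed
  qed
  \<comment> \<open>Rotating \<open>x\<close> by a unimodular scalar makes the value real and
    non-negative, so the bound on real parts bounds the modulus.\<close>
  have norm_f: "norm (f x) \<le> norm x" for x
  proof -
    obtain c where c: "norm c = 1" "c * f x = of_real (norm (f x))"
      using unimodular_rotation by blast
    have "norm (f x) = re (f (s c x))"
      by (simp add: f_scale c)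
    also have "\<dots> \<le> norm (s c x)"
      unfolding re_f by (rule le)
    finally show ?thesis
      by (simp add: norm_scale c)
  qed
  have "bounded_linear f"
  proof (rule bounded_linear_intro[where K = 1])
    show "f (x + y) = f x + f y" for x y
      by (simp add: f_def scale_right_distrib linear_add[OF q] algebra_simps)
    show "f (r *\<^sub>R x) = r *\<^sub>R f x" for r x
      using f_scale[of "of_real r" x] by (simp add: scale_of_real scaleR_conv_of_real)
  qed (use norm_f in simp)
  then show thesis
    using that dual_ballI f_scale norm_f re_f by metis
qed

text \<open>A functional on a subspace is given by its graph as a relation; the norm bound together
  with linearity makes it single-valued. Hence no well-definedness has to be shown when subspace
  elements have several representations.\<close>

lemma hahn_banach_graph:
  assumes ne: "G \<noteq> {}"
    and add: "\<And>w r v t. (w, r) \<in> G \<Longrightarrow> (v, t) \<in> G \<Longrightarrow> (w + v, r + t) \<in> G"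
    and scale: "\<And>c w r. (w, r) \<in> G \<Longrightarrow> (s c w, c * r) \<in> G"
    and le: "\<And>w r. (w, r) \<in> G \<Longrightarrow> norm r \<le> norm w"
  obtains f where "f \<in> dual_ball s" "\<And>w r. (w, r) \<in> G \<Longrightarrow> f w = r"
proof -
  define H where "H = {(w, re r) | w r. (w, r) \<in> G}"
  have H: "(w, re r) \<in> H" if "(w, r) \<in> G" for w r
    using that by (auto simp: H_def)
  obtain q where q: "linear q" "\<And>x. q x \<le> norm x" "\<And>w r. (w, r) \<in> H \<Longrightarrow> r \<le> q w"
  proof (rule hahn_banach_cone[OF sublinear_norm, of H])
    show "(0, 0) \<in> H"
      using ne scale[of _ _ 0] H[of 0 0] by fastforce
    show "(w + v, r + t) \<in> H" if "(w, r) \<in> H" "(v, t) \<in> H" for w r v t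
      using that add unfolding H_def by (force simp: re_add)
    show "(t *\<^sub>R w, t * r) \<in> H" if "t > 0" "(w, r) \<in> H" for t w r
    proof -
      obtain r' where "(w, r') \<in> G" "r = re r'"
        using \<open>(w, r) \<in> H\<close> by (auto simp: H_def)
      then show ?thesis
        using H[OF scale, of w r' "of_real t"] by (simp add: re_of_real_mult scale_of_real)
    qed
    show "r \<le> norm w" if "(w, r) \<in> H" for w r
      using that le re_le_norm order_trans by (fastforce simp: H_def)
  qed blast
  \<comment> \<open>\<open>G\<close> is symmetric, so the lower bounds at \<open>w\<close> and at
    \<open>- w\<close> combine to an equality.\<close>
  have q_eq: "q w = re r" if "(w, r) \<in> G" for w r
  proof (rule antisym)
    have "re (- r) \<le> q (- w)"
      using q(3)[OF H[OF scale[OF that, of "- 1"]]] by simp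
    then show "q w \<le> re r"
      by (simp add: re_minus linear_neg[OF q(1)])
  qed (rule q(3)[OF H[OF that]])
  obtain f where f: "f \<in> dual_ball s" "\<And>x. re (f x) = q x"
    using real_functional_extends[OF q(1,2)] by blast
  have "f w = r" if "(w, r) \<in> G" for w r
  proof (rule eq_if_re_mult_eq)
    fix c
    show "re (c * f w) = re (c * r)"
      using f(2)[of "s c w"] q_eq[OF scale[OF that]] by (simp add: dual_ball_scale[OF f(1)])
  qed
  with f(1) show thesis
    by (rule that)
qed

text \<open>The bound says that the prescribed values define a functional of norm at most 1 on the
  span of \<open>x\<close> and \<open>y\<close>, which may be linearly dependent.\<close>

lemma hahn_banach_two_points:
  assumes le: "\<And>a b. norm (a * k + b * l) \<le> norm (s a x + s b y)"
  obtains f where "f \<in> dual_ball s" "f x = k" "f y = l"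
proof -
  define G where "G = {(s a x + s b y, a * k + b * l) | a b. True}"
  have G: "(s a x + s b y, a * k + b * l) \<in> G" for a b
    by (auto simp: G_def)
  obtain f where f: "f \<in> dual_ball s" "\<And>w r. (w, r) \<in> G \<Longrightarrow> f w = r"
  proof (rule hahn_banach_graph[of G])
    show "(w + v, r + t) \<in> G" if wr: "(w, r) \<in> G" and vt: "(v, t) \<in> G" for w r v t
    proof -
      obtain a b where "w = s a x + s b y" "r = a * k + b * l"
        using wr by (auto simp: G_def)
      moreover obtain a' b' where "v = s a' x + s b' y" "t = a' * k + b' * l"
        using vt by (auto simp: G_def)
      ultimately show ?thesis
        using G[of "a + a'" "b + b'"] by (simp add: scale_left_distrib algebra_simps)
    qed
    show "(s c w, c * r) \<in> G" if wr: "(w, r) \<in> G" for c w r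
    proof -
      obtain a b where "w = s a x + s b y" "r = a * k + b * l"
        using wr by (auto simp: G_def)
      then show ?thesis
        using G[of "c * a" "c * b"] by (simp add: scale_right_distrib algebra_simps)
    qed
  qed (use le in \<open>auto simp: G_def\<close>)
  show thesis
    using that[OF f(1)] f(2)[OF G[of 1 0]] f(2)[OF G[of 0 1]] by simp
qed

lemma exists_norming_functional:
  obtains f where "f \<in> dual_ball s" "f x = of_real (norm x)"
  by (rule hahn_banach_two_points[of "of_real (norm x)" 0 x 0])
    (auto simp: norm_mult norm_scale)

end

section \<open>Norming sets of functionals\<close>

text \<open>A point of the disc of radius \<open>R\<close> whose real part is close to
  \<open>R\<close> is itself close to \<open>R\<close>: expanding the square bounds its squared
  distance by \<open>2 * R * (R - re (x n))\<close>.\<close>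

lemma tendsto_of_real_if_re:
  fixes x :: "nat \<Rightarrow> 'k::real_or_complex_field"
  assumes le: "\<And>n. norm (x n) \<le> R" and lim: "(\<lambda>n. re (x n)) \<longlonglongrightarrow> R"
  shows "x \<longlonglongrightarrow> of_real R"
proof -
  have bound: "(norm (x n - of_real R))\<^sup>2 \<le> 2 * R * (R - re (x n))" for n
  proof -
    have "(norm (x n - of_real R))\<^sup>2 = (cmod (emb (x n) - of_real R))\<^sup>2"
      using norm_emb[of "x n - of_real R"] by (simp add: emb_diff)
    also have "\<dots> = (cmod (emb (x n)))\<^sup>2 - 2 * R * re (x n) + R\<^sup>2"
      unfolding cmod_power2 re_def by (simp add: power2_eq_square algebra_simps)
    also have "(cmod (emb (x n)))\<^sup>2 \<le> R\<^sup>2"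
      using le[of n] by (simp add: power_mono)
    finally show ?thesis
      by (simp add: power2_eq_square algebra_simps)
  qed
  have "(\<lambda>n. (norm (x n - of_real R))\<^sup>2) \<longlonglongrightarrow> 0"
  proof (rule tendsto_sandwich)
    show "\<forall>\<^sub>F n in sequentially. 0 \<le> (norm (x n - of_real R))\<^sup>2"
      by simp
    show "\<forall>\<^sub>F n in sequentially. (norm (x n - of_real R))\<^sup>2 \<le> 2 * R * (R - re (x n))"
      using bound by (rule always_eventually[OF allI])
    have "(\<lambda>n. 2 * R * (R - re (x n))) \<longlonglongrightarrow> 2 * R * (R - R)"
      by (intro tendsto_intros lim)
    then show "(\<lambda>n. 2 * R * (R - re (x n))) \<longlonglongrightarrow> 0"
      by simp
  qed simp
  then have "(\<lambda>n. sqrt ((norm (x n - of_real R))\<^sup>2)) \<longlonglongrightarrow> sqrt 0"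
    by (rule tendsto_real_sqrt)
  then show ?thesis
    by (simp add: tendsto_norm_zero_iff LIM_zero_iff)
qed

text \<open>The set \<open>limit_set\<close> for an arbitrary set \<open>D\<close> of functionals,
  so that the geometric arguments can be made without tensor products.\<close>

definition limit_values :: "('a::banach \<Rightarrow> 'k::real_or_complex_field) set \<Rightarrow> 'a \<Rightarrow> 'a \<Rightarrow> 'k set"
  where "limit_values D u z =
    {l. \<exists>h :: nat \<Rightarrow> 'a \<Rightarrow> 'k. (\<forall>n. h n \<in> D) \<and>
          (\<lambda>n. h n u) \<longlonglongrightarrow> of_real (norm u) \<and> (\<lambda>n. h n z) \<longlonglongrightarrow> l}"

text \<open>The limit values form the slice over \<open>norm u\<close> of the closure of all pairs
  \<open>(h u, h z)\<close>, hence a closed set.\<close>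

lemma closed_limit_values: "closed (limit_values D u z)"
proof -
  have "l \<in> limit_values D u z \<longleftrightarrow> (of_real (norm u), l) \<in> closure ((\<lambda>h. (h u, h z)) ` D)" for l
  proof
    assume "l \<in> limit_values D u z"
    then obtain h where "\<forall>n. h n \<in> D" "(\<lambda>n. h n u) \<longlonglongrightarrow> of_real (norm u)" "(\<lambda>n. h n z) \<longlonglongrightarrow> l"
      by (auto simp: limit_values_def)
    then show "(of_real (norm u), l) \<in> closure ((\<lambda>h. (h u, h z)) ` D)"
      unfolding closure_sequential
      by (intro exI[of _ "\<lambda>n. (h n u, h n z)"]) (auto intro: tendsto_Pair)
  next
    assume "(of_real (norm u), l) \<in> closure ((\<lambda>h. (h u, h z)) ` D)"
    then obtain x where x: "\<forall>n. x n \<in> (\<lambda>h. (h u, h z)) ` D" "x \<longlonglongrightarrow> (of_real (norm u), l)"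
      unfolding closure_sequential by blast
    then have "\<forall>n. \<exists>h. h \<in> D \<and> x n = (h u, h z)"
      by blast
    then obtain h where h: "\<And>n. h n \<in> D" "\<And>n. x n = (h n u, h n z)"
      by metis
    then show "l \<in> limit_values D u z"
      using tendsto_fst[OF x(2)] tendsto_snd[OF x(2)]
      by (auto simp: limit_values_def intro!: exI[of _ h])
  qed
  then have "limit_values D u z = Pair (of_real (norm u)) -` closure ((\<lambda>h. (h u, h z)) ` D)"
    by auto
  then show ?thesis
    by (simp add: closed_vimage continuous_intros)
qed

text \<open>Real parts occur instead of moduli because the values at \<open>u\<close> have to
  approach \<open>norm u\<close> itself.\<close>

locale norming_set = banach_space_over s
  for s :: "'k::real_or_complex_field \<Rightarrow> 'a::banach \<Rightarrow> 'a" +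
  fixes D :: "('a \<Rightarrow> 'k) set"
  assumes subset_dual_ball: "D \<subseteq> dual_ball s"
    and norming: "e > 0 \<Longrightarrow> \<exists>h\<in>D. norm z - e < re (h z)"
begin

lemma limit_valuesD:
  assumes "l \<in> limit_values D u z"
  shows "\<exists>h. (\<forall>n. h n \<in> D) \<and> (\<forall>n. h n \<in> dual_ball s) \<and>
    (\<lambda>n. h n u) \<longlonglongrightarrow> of_real (norm u) \<and> (\<lambda>n. h n z) \<longlonglongrightarrow> l"
  using assms subset_dual_ball unfolding limit_values_def by blast

lemma compact_limit_values: "compact (limit_values D u z)"
proof -
  have "norm l \<le> norm z" if "l \<in> limit_values D u z" for l
  proof -
    obtain h where h: "\<And>n. h n \<in> dual_ball s"
      "(\<lambda>n. h n u) \<longlonglongrightarrow> of_real (norm u)" "(\<lambda>n. h n z) \<longlonglongrightarrow> l"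
      using limit_valuesD[OF \<open>l \<in> _\<close>] by auto
    show ?thesis
      by (rule LIMSEQ_le_const2[OF tendsto_norm[OF h(3)]])
        (use dual_ball_norm_le[OF h(1)] in blast)
  qed
  then have "bounded (limit_values D u z)"
    by (auto simp: bounded_iff)
  then show ?thesis
    using closed_limit_values compact_eq_bounded_closed by blast
qed

text \<open>
  Functionals in \<open>D\<close> that almost norm \<open>u + t z\<close> for small \<open>t > 0\<close> also almost norm \<open>u\<close>, and their
  values at \<open>z\<close> bound the one-sided derivative of the norm at \<open>u\<close> in the direction \<open>z\<close>.
\<close>

lemma exists_directional_limit_value:
  obtains l where "l \<in> limit_values D u z"
    "\<And>m. (\<And>t. t > 0 \<Longrightarrow> norm u + t * m \<le> norm (u + t *\<^sub>R z)) \<Longrightarrow> m \<le> re l"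
proof -
  define t where "t n = inverse (real (Suc n))" for n
  have t_pos: "t n > 0" for n
    by (simp add: t_def)
  have t_lim: "t \<longlonglongrightarrow> 0"
    unfolding t_def by (rule LIMSEQ_inverse_real_of_nat)
  \<comment> \<open>The error is of second order in \<open>t n\<close>, so it still tends to 0 after
    the division by \<open>t n\<close> below.\<close>
  have "\<forall>n. \<exists>h\<in>D. norm (u + t n *\<^sub>R z) - t n * t n < re (h (u + t n *\<^sub>R z))"
    using norming t_pos by simp
  then obtain h where hD: "\<And>n. h n \<in> D"
    and h: "\<And>n. norm (u + t n *\<^sub>R z) - t n * t n < re (h n (u + t n *\<^sub>R z))"
    by metis
  have hB: "h n \<in> dual_ball s" for n
    using hD subset_dual_ball by blast
  have h': "norm (u + t n *\<^sub>R z) - t n * t n < re (h n u) + t n * re (h n z)" for n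
    using h[of n] dual_ball_scale[OF hB, of n "of_real (t n)" z]
    by (simp add: dual_ball_add[OF hB] re_add re_of_real_mult scale_of_real)
  have "bounded (range (\<lambda>n. h n z))"
    using dual_ball_norm_le[OF hB] by (auto simp: bounded_iff)
  then obtain l r where r: "strict_mono (r :: nat \<Rightarrow> nat)" and l: "(\<lambda>n. h (r n) z) \<longlonglongrightarrow> l"
    using bounded_imp_convergent_subsequence by (force simp: o_def)
  have "(\<lambda>n. re (h n u)) \<longlonglongrightarrow> norm u"
  proof (rule tendsto_sandwich)
    \<comment> \<open>Replacing \<open>u + t n *\<^sub>R z\<close> by \<open>u\<close> costs
      \<open>t n * norm z\<close> twice: once in the norm and once in the functional.\<close>
    have "norm u - 2 * t n * norm z - t n * t n \<le> re (h n u)" for n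
    proof -
      have "norm u \<le> norm (u + t n *\<^sub>R z) + t n * norm z"
        using norm_triangle_ineq4[of "u + t n *\<^sub>R z" "t n *\<^sub>R z"] t_pos[of n] by simp
      moreover have "t n * re (h n z) \<le> t n * norm z"
        using t_pos[of n] re_le_norm[of "h n z"] dual_ball_norm_le[OF hB, of n z]
        by (intro mult_left_mono) auto
      ultimately show ?thesis
        using h'[of n] by simp
    qed
    then show "\<forall>\<^sub>F n in sequentially. norm u - 2 * t n * norm z - t n * t n \<le> re (h n u)"
      by simp
    show "\<forall>\<^sub>F n in sequentially. re (h n u) \<le> norm u"
      using re_le_norm dual_ball_norm_le[OF hB] order_trans by (intro always_eventually) blast
    have "(\<lambda>n. norm u - 2 * t n * norm z - t n * t n) \<longlonglongrightarrow> norm u - 2 * 0 * norm z - 0 * 0"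
      by (intro tendsto_intros t_lim)
    then show "(\<lambda>n. norm u - 2 * t n * norm z - t n * t n) \<longlonglongrightarrow> norm u"
      by simp
  qed simp
  then have "(\<lambda>n. h n u) \<longlonglongrightarrow> of_real (norm u)"
    by (intro tendsto_of_real_if_re dual_ball_norm_le[OF hB])
  then have "(\<lambda>n. h (r n) u) \<longlonglongrightarrow> of_real (norm u)"
    using LIMSEQ_subseq_LIMSEQ[OF _ r] by (force simp: o_def)
  then have "l \<in> limit_values D u z"
    using hD l by (auto simp: limit_values_def intro!: exI[of _ "\<lambda>n. h (r n)"])
  \<comment> \<open>Such an \<open>m\<close> bounds all difference quotients from below. Cancelling
    \<open>re (h n u) \<le> norm u\<close> and dividing by \<open>t n\<close> leaves only the error
    \<open>t n\<close>.\<close>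
  moreover have "m \<le> re l" if m: "\<And>t. t > 0 \<Longrightarrow> norm u + t * m \<le> norm (u + t *\<^sub>R z)" for m
  proof -
    have "m \<le> re (h n z) + t n" for n
    proof -
      have "re (h n u) \<le> norm u"
        using re_le_norm dual_ball_norm_le[OF hB] order_trans by blast
      then have "t n * m \<le> t n * (re (h n z) + t n)"
        using m[OF t_pos[of n]] h'[of n] by (simp add: algebra_simps)
      then show ?thesis
        using t_pos[of n] by simp
    qed
    moreover have "(\<lambda>n. re (h (r n) z) + t (r n)) \<longlonglongrightarrow> re l + 0"
      using LIMSEQ_subseq_LIMSEQ[OF t_lim r] by (intro tendsto_intros tendsto_re l) (simp add: o_def)
    ultimately show ?thesis
      using LIMSEQ_le_const[of "\<lambda>n. re (h (r n) z) + t (r n)" "re l + 0" m] by simp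
  qed
  ultimately show thesis
    by (rule that)
qed

lemma limit_values_nonempty: "limit_values D u z \<noteq> {}"
  by (rule exists_directional_limit_value[of u z]) auto

lemma limit_values_scale:
  assumes "l \<in> limit_values D u z"
  shows "c * l \<in> limit_values D u (s c z)"
proof -
  obtain h where h: "\<And>n. h n \<in> D" "\<And>n. h n \<in> dual_ball s"
    "(\<lambda>n. h n u) \<longlonglongrightarrow> of_real (norm u)" "(\<lambda>n. h n z) \<longlonglongrightarrow> l"
    using limit_valuesD[OF assms] by auto
  have "(\<lambda>n. h n (s c z)) \<longlonglongrightarrow> c * l"
    unfolding dual_ball_scale[OF h(2)] by (intro tendsto_intros h(4))
  with h(1,3) show ?thesis
    by (auto simp: limit_values_def intro!: exI[of _ h])
qed

text \<open>The norm bound on the functionals passes to the limit. This is the hypothesis of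
  \<open>hahn_banach_two_points\<close>, and it also gives the easy direction of the orthogonality
  criterion.\<close>

lemma limit_value_norm_le:
  assumes "l \<in> limit_values D u z"
  shows "norm (a * of_real (norm u) + b * l) \<le> norm (s a u + s b z)"
proof -
  obtain h where h: "\<And>n. h n \<in> dual_ball s"
    "(\<lambda>n. h n u) \<longlonglongrightarrow> of_real (norm u)" "(\<lambda>n. h n z) \<longlonglongrightarrow> l"
    using limit_valuesD[OF assms] by auto
  have lim: "(\<lambda>n. norm (a * h n u + b * h n z)) \<longlonglongrightarrow> norm (a * of_real (norm u) + b * l)"
    by (intro tendsto_intros h)
  have le: "norm (a * h n u + b * h n z) \<le> norm (s a u + s b z)" for n
    using dual_ball_norm_le[OF h(1), of n "s a u + s b z"]
    by (simp add: dual_ball_add[OF h(1)] dual_ball_scale[OF h(1)])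
  show ?thesis
    by (rule LIMSEQ_le_const2[OF lim]) (use le in blast)
qed

lemma limit_value_attained:
  assumes "l \<in> limit_values D u z"
  obtains f where "f \<in> dual_ball s" "f u = of_real (norm u)" "f z = l"
  using hahn_banach_two_points limit_value_norm_le[OF assms] by metis

section \<open>Birkhoff-James orthogonality\<close>

theorem bj_orthogonal_iff: "bj_orthogonal s u z \<longleftrightarrow> 0 \<in> convex hull limit_values D u z"
proof
  assume orth: "bj_orthogonal s u z"
  show "0 \<in> convex hull limit_values D u z"
  proof (rule ccontr)
    assume "0 \<notin> convex hull limit_values D u z"
    then obtain c where c: "\<And>l. l \<in> limit_values D u z \<Longrightarrow> re (c * l) < 0"
      using separation_from_zero[OF compact_limit_values] by blast
    then have "c \<noteq> 0"
      using limit_values_nonempty[of u z] by force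
    \<comment> \<open>Orthogonality makes the difference quotients in the direction
      \<open>s c z\<close> non-negative, so \<open>m = 0\<close> is admissible and
      \<open>re l\<close> cannot be negative.\<close>
    obtain l where l: "l \<in> limit_values D u (s c z)"
      "\<And>m. (\<And>t. t > 0 \<Longrightarrow> norm u + t * m \<le> norm (u + t *\<^sub>R s c z)) \<Longrightarrow> m \<le> re l"
      using exists_directional_limit_value by blast
    have "norm u \<le> norm (u + t *\<^sub>R s c z)" for t
      using orth by (simp add: bj_orthogonal_def flip: scale_of_real)
    then have "0 \<le> re l"
      by (intro l(2)) simp
    moreover have "inverse c * l \<in> limit_values D u z"
      using limit_values_scale[OF l(1), of "inverse c"] \<open>c \<noteq> 0\<close> by simp
    then have "re l < 0"
      using c[of "inverse c * l"] \<open>c \<noteq> 0\<close> by (simp flip: mult.assoc)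
    ultimately show False
      by simp
  qed
next
  assume hull: "0 \<in> convex hull limit_values D u z"
  have "norm u \<le> norm (u + s c z)" for c
  proof -
    \<comment> \<open>A convex set that contains all limit values and contains 0 exactly when the
      desired inequality holds for \<open>c\<close>.\<close>
    define S where "S = {l. re (c * l) \<le> norm (u + s c z) - norm u}"
    have "bounded_linear (\<lambda>l. re (c * l))"
      by (rule bounded_linear_compose[OF bounded_linear_re bounded_linear_mult_right])
    then have "convex ((\<lambda>l. re (c * l)) -` {.. norm (u + s c z) - norm u})"
      by (intro convex_linear_vimage bounded_linear.linear) auto
    then have "convex S"
      by (simp add: S_def vimage_def)
    moreover have "limit_values D u z \<subseteq> S"
    proof
      fix l assume "l \<in> limit_values D u z"
      then have "norm (of_real (norm u) + c * l) \<le> norm (u + s c z)"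
        using limit_value_norm_le[of l u z 1 c] by simp
      then show "l \<in> S"
        using re_le_norm[of "of_real (norm u) + c * l"] by (simp add: S_def re_add)
    qed
    ultimately have "0 \<in> S"
      using hull hull_minimal[of _ S convex] by blast
    then show ?thesis
      by (simp add: S_def)
  qed
  then show "bj_orthogonal s u z"
    by (simp add: bj_orthogonal_def)
qed

section \<open>Smooth points\<close>

text \<open>The support functionals at 0 are all functionals of norm 1, a set closed under negation;
  a unique element would have to be 0.\<close>

lemma not_smooth_point_zero: "\<not> smooth_point s 0"
proof
  define S where "S = {f \<in> dual_space s. onorm f = 1 \<and> f 0 = of_real (norm (0 :: 'a))}"
  assume "smooth_point s 0"
  then obtain f where f: "S = {f}"
    unfolding smooth_point_def S_def by (rule is_singletonE)
  then have "f \<in> S"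
    by simp
  then have "f \<in> dual_space s" "onorm f = 1" "f 0 = 0"
    by (simp_all add: S_def)
  then have "(\<lambda>x. - f x) \<in> S"
    by (simp add: S_def dual_space_def onorm_neg bounded_linear_minus)
  then have "(\<lambda>x. - f x) = f"
    unfolding f by simp
  then have "f x = 0" for x
    using fun_cong[of "\<lambda>x. - f x" f x] by simp
  then have "f = (\<lambda>x. 0)"
    by (rule ext)
  then show False
    using \<open>onorm f = 1\<close> onorm_zero[where 'a = 'a and 'b = 'k] by simp
qed

text \<open>At 0 constant sequences show that every \<open>h z\<close> with \<open>h\<close> in
  \<open>D\<close> is a limit value. Almost norming \<open>z\<close> and \<open>- z\<close> with
  error below \<open>norm z\<close> gives values with real parts of opposite signs.\<close>

lemma limit_values_zero_not_singleton:
  assumes "z \<noteq> 0"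
  shows "\<not> is_singleton (limit_values D 0 z)"
proof -
  have attained: "h z \<in> limit_values D 0 z" if "h \<in> D" for h
  proof -
    have "h 0 = 0"
      using that subset_dual_ball dual_ball_norm_le[of h s 0] by auto
    then show ?thesis
      using that by (auto simp: limit_values_def intro!: exI[of _ "\<lambda>_. h"])
  qed
  obtain h1 where h1: "h1 \<in> D" "0 < re (h1 z)"
    using norming[of "norm z" z] assms by auto
  obtain h2 where h2: "h2 \<in> D" "0 < re (h2 (- z))"
    using norming[of "norm z" "- z"] assms by auto
  have "h2 (- z) = - h2 z"
    using h2(1) subset_dual_ball dual_ball_scale[of h2 s "- 1" z] by auto
  then have "h1 z \<noteq> h2 z"
    using h1(2) h2(2) by (auto simp: re_minus)
  then show ?thesis
    using attained[OF h1(1)] attained[OF h2(1)] by (auto simp: is_singleton_def)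
qed

text \<open>The value \<open>norm u\<close> at a non-zero \<open>u\<close> forces norm at least 1,
  so the unit sphere may be replaced by the ball, where Hahn-Banach delivers its
  functionals.\<close>

lemma smooth_point_iff_dual_ball:
  assumes "u \<noteq> 0"
  shows "smooth_point s u \<longleftrightarrow> is_singleton {f \<in> dual_ball s. f u = of_real (norm u)}"
proof -
  have "onorm f = 1" if "bounded_linear f" "onorm f \<le> 1" "f u = of_real (norm u)" for f :: "'a \<Rightarrow> 'k"
    using that onorm[of f u] assms by simp
  then have "{f \<in> dual_space s. onorm f = 1 \<and> f u = of_real (norm u)}
      = {f \<in> dual_ball s. f u = of_real (norm u)}"
    by (auto simp: dual_ball_def dual_space_def)
  then show ?thesis
    by (simp add: smooth_point_def)
qed

text \<open>\<open>re (f z)\<close> bounds the difference quotients from below, hence is at most the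
  real part of the only limit value; the same argument at \<open>- z\<close> gives the reverse
  inequality.\<close>

lemma support_functional_value:
  assumes f: "f \<in> dual_ball s" "f u = of_real (norm u)"
    and singleton: "\<And>z. is_singleton (limit_values D u z)"
    and l: "l \<in> limit_values D u z"
  shows "re (f z) = re l"
proof -
  have le: "re (f z) \<le> re l" if l: "l \<in> limit_values D u z" for l z
  proof -
    obtain l' where l': "l' \<in> limit_values D u z"
      "\<And>m. (\<And>t. t > 0 \<Longrightarrow> norm u + t * m \<le> norm (u + t *\<^sub>R z)) \<Longrightarrow> m \<le> re l'"
      using exists_directional_limit_value by blast
    have "norm u + t * re (f z) \<le> norm (u + t *\<^sub>R z)" for t
    proof -
      have "f (u + t *\<^sub>R z) = of_real (norm u) + of_real t * f z"
        using f(2) dual_ball_scale[OF f(1), of "of_real t" z]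
        by (simp add: dual_ball_add[OF f(1)] scale_of_real)
      then have "norm u + t * re (f z) = re (f (u + t *\<^sub>R z))"
        by (simp add: re_add re_of_real_mult)
      also have "\<dots> \<le> norm (u + t *\<^sub>R z)"
        using re_le_norm dual_ball_norm_le[OF f(1)] order_trans by blast
      finally show ?thesis .
    qed
    then have "re (f z) \<le> re l'"
      by (intro l'(2))
    moreover have "l' = l"
      using singleton[of z] l l'(1) by (auto simp: is_singleton_def)
    ultimately show ?thesis
      by simp
  qed
  have "re (f (s (- 1) z)) \<le> re (- 1 * l)"
    by (rule le[OF limit_values_scale[OF l]])
  then have "re l \<le> re (f z)"
    unfolding dual_ball_scale[OF f(1)] by (simp add: re_minus)
  with le[OF l] show ?thesis
    by simp
qed

text \<open>The zero space has to be excluded: it has no functional of norm 1, hence no smooth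
  point, while its limit values form the singleton of 0.\<close>

theorem smooth_point_iff:
  assumes "\<exists>x::'a. x \<noteq> 0"
  shows "smooth_point s u \<longleftrightarrow> (\<forall>z. is_singleton (limit_values D u z))"
proof (cases "u = 0")
  case True
  then show ?thesis
    using not_smooth_point_zero limit_values_zero_not_singleton assms by blast
next
  case False
  show ?thesis
    unfolding smooth_point_iff_dual_ball[OF False]
  proof
    assume "is_singleton {f \<in> dual_ball s. f u = of_real (norm u)}"
    then obtain f where f: "{f \<in> dual_ball s. f u = of_real (norm u)} = {f}"
      by (auto simp: is_singleton_def)
    \<comment> \<open>Each limit value is attained by a support functional, and \<open>f\<close> is
      the only one.\<close>
    have *: "l = f z" if l: "l \<in> limit_values D u z" for l z
    proof -
      obtain g where "g \<in> dual_ball s" "g u = of_real (norm u)" "g z = l"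
        using l by (rule limit_value_attained)
      moreover from this have "g \<in> {f}"
        unfolding f[symmetric] by simp
      ultimately show ?thesis
        by simp
    qed
    have "limit_values D u z = {f z}" for z
      using limit_values_nonempty[of u z] *[of _ z] by auto
    then show "\<forall>z. is_singleton (limit_values D u z)"
      by simp
  next
    assume "\<forall>z. is_singleton (limit_values D u z)"
    then have singleton: "\<And>z. is_singleton (limit_values D u z)"
      by blast
    obtain f where f: "f \<in> dual_ball s" "f u = of_real (norm u)"
      using exists_norming_functional by blast
    have "g = f" if g: "g \<in> dual_ball s" "g u = of_real (norm u)" for g
    proof
      fix z
      show "g z = f z"
      proof (rule eq_if_re_mult_eq)
        fix c
        obtain l where "l \<in> limit_values D u (s c z)"
          using limit_values_nonempty by blast
        then have "re (g (s c z)) = re (f (s c z))"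
          using support_functional_value[OF f singleton] support_functional_value[OF g singleton]
          by metis
        then show "re (c * g z) = re (c * f z)"
          by (simp add: dual_ball_scale[OF f(1)] dual_ball_scale[OF g(1)])
      qed
    qed
    then have "{f \<in> dual_ball s. f u = of_real (norm u)} = {f}"
      using f by blast
    then show "is_singleton {f \<in> dual_ball s. f u = of_real (norm u)}"
      by simp
  qed
qed

end

section \<open>The injective tensor product\<close>

context injective_tensor_product
begin

abbreviation tensor_sum :: "('a \<times> 'b) list \<Rightarrow> 'c"
  where "tensor_sum ps \<equiv> (\<Sum>(x, y)\<leftarrow>ps. tens x y)"

abbreviation eval_sum :: "('a \<Rightarrow> 'k) \<Rightarrow> ('b \<Rightarrow> 'k) \<Rightarrow> ('a \<times> 'b) list \<Rightarrow> 'k"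
  where "eval_sum f g ps \<equiv> (\<Sum>(x, y)\<leftarrow>ps. f x * g y)"

lemma tens_scale_left: "tens (sX c x) y = sZ c (tens x y)"
proof -
  interpret l: Vector_Spaces.linear sX sZ "\<lambda>x. tens x y"
    by (rule linear_left)
  show ?thesis
    by (rule l.scale)
qed

text \<open>Boundedness gives the real \<open>Sup\<close> in the injective norm its upper bound
  property; the sum of the products of norms is a bound.\<close>

lemma bdd_above_injective_norm:
  "bdd_above {norm (eval_sum f g ps) | f g. f \<in> dual_ball sX \<and> g \<in> dual_ball sY}"
proof (rule bdd_aboveI)
  have "norm (eval_sum f g ps) \<le> (\<Sum>(x, y)\<leftarrow>ps. norm x * norm y)"
    if fg: "f \<in> dual_ball sX" "g \<in> dual_ball sY" for f g
  proof (induction ps)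
    case (Cons p ps)
    obtain x y where p: "p = (x, y)"
      by fastforce
    have "norm (f x * g y) \<le> norm x * norm y"
      using dual_ball_norm_le[OF fg(1), of x] dual_ball_norm_le[OF fg(2), of y]
      by (simp add: norm_mult mult_mono)
    then have "norm (f x * g y + eval_sum f g ps)
        \<le> norm x * norm y + (\<Sum>(x, y)\<leftarrow>ps. norm x * norm y)"
      using Cons by (rule norm_triangle_mono)
    then show ?case
      by (simp add: p)
  qed simp
  then show "r \<le> (\<Sum>(x, y)\<leftarrow>ps. norm x * norm y)"
    if "r \<in> {norm (eval_sum f g ps) | f g. f \<in> dual_ball sX \<and> g \<in> dual_ball sY}" for r
    using that by auto
qed

lemma norm_eval_sum_le:
  assumes "f \<in> dual_ball sX" "g \<in> dual_ball sY"
  shows "norm (eval_sum f g ps) \<le> norm (tensor_sum ps)"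
  unfolding norm_tensor injective_norm_def
  by (rule cSup_upper[OF _ bdd_above_injective_norm]) (use assms in blast)

lemma tensor_sum_approximately_attained:
  assumes "e > 0"
  obtains f g where "f \<in> dual_ball sX" "g \<in> dual_ball sY"
    "norm (tensor_sum ps) - e < norm (eval_sum f g ps)"
proof -
  define S where "S = {norm (eval_sum f g ps) | f g. f \<in> dual_ball sX \<and> g \<in> dual_ball sY}"
  have "norm (eval_sum (\<lambda>_. 0) (\<lambda>_. 0) ps) \<in> S"
    unfolding S_def by (rule CollectI, intro exI conjI, rule refl) (rule dual_ball_zero)+
  then have "S \<noteq> {}"
    by blast
  moreover have "norm (tensor_sum ps) - e < Sup S"
    using assms by (simp add: norm_tensor injective_norm_def S_def)
  ultimately obtain r where r: "r \<in> S" "norm (tensor_sum ps) - e < r"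
    using less_cSupD[of S "norm (tensor_sum ps) - e"] by auto
  then obtain f g where "f \<in> dual_ball sX" "g \<in> dual_ball sY" "r = norm (eval_sum f g ps)"
    unfolding S_def by blast
  with r(2) show thesis
    by (intro that) simp_all
qed

lemma dual_space_eq_on_tensor_sums:
  assumes h: "h \<in> dual_space sZ" "\<And>x y. h (tens x y) = f x * g y"
  shows "h (tensor_sum ps) = eval_sum f g ps"
proof -
  have lin: "linear h"
    using h(1) by (auto simp: dual_space_def bounded_linear.linear)
  show ?thesis
    by (induction ps) (auto simp: linear_0[OF lin] linear_add[OF lin] h(2))
qed

text \<open>Continuous functionals that agree on the dense set of tensor sums coincide; this is the
  uniqueness behind \<open>THE\<close> in \<open>tensor_functional\<close>.\<close>

lemma dual_space_eq_if_eq_on_tensors: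
  assumes h: "h \<in> dual_space sZ" "\<And>x y. h (tens x y) = f x * g y"
    and k: "k \<in> dual_space sZ" "\<And>x y. k (tens x y) = f x * g y"
  shows "h = k"
proof -
  have "continuous_on UNIV h" "continuous_on UNIV k"
    using h(1) k(1) by (auto simp: dual_space_def linear_continuous_on)
  then have "closed {z. h z = k z}"
    by (rule closed_Collect_eq)
  moreover have "range tensor_sum \<subseteq> {z. h z = k z}"
    using dual_space_eq_on_tensor_sums[OF h] dual_space_eq_on_tensor_sums[OF k] by auto
  ultimately have "UNIV \<subseteq> {z. h z = k z}"
    using closure_minimal dense_tensors by metis
  then show ?thesis
    by auto
qed

text \<open>Hahn-Banach extends the functional from the tensor sums. Independence of the
  representation is contained in the bound by the injective norm.\<close>

lemma exists_tensor_functional: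
  assumes fg: "f \<in> dual_ball sX" "g \<in> dual_ball sY"
  obtains h where "h \<in> dual_ball sZ" "\<And>x y. h (tens x y) = f x * g y"
proof -
  define G where "G = {(tensor_sum ps, eval_sum f g ps) | ps. True}"
  have G: "(tensor_sum ps, eval_sum f g ps) \<in> G" for ps
    by (auto simp: G_def)
  have scale: "(sZ c (tensor_sum ps), c * eval_sum f g ps) \<in> G" for c ps
  proof -
    \<comment> \<open>Scaling the left factors realises scalar multiplication on lists of
      pairs.\<close>
    have "tensor_sum (map (\<lambda>(x, y). (sX c x, y)) ps) = sZ c (tensor_sum ps)
        \<and> eval_sum f g (map (\<lambda>(x, y). (sX c x, y)) ps) = c * eval_sum f g ps"
      by (induction ps) (auto simp: tens_scale_left dual_ball_scale[OF fg(1)]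
          Z.scale_right_distrib algebra_simps)
    then show ?thesis
      using G by metis
  qed
  obtain h where h: "h \<in> dual_ball sZ" "\<And>w r. (w, r) \<in> G \<Longrightarrow> h w = r"
  proof (rule Z.hahn_banach_graph[of G])
    show "G \<noteq> {}"
      using G by blast
    show "(w + v, r + t) \<in> G" if wr: "(w, r) \<in> G" and vt: "(v, t) \<in> G" for w r v t
    proof -
      obtain ps qs where "w = tensor_sum ps" "r = eval_sum f g ps"
        "v = tensor_sum qs" "t = eval_sum f g qs"
        using wr vt unfolding G_def by blast
      then show ?thesis
        using G[of "ps @ qs"] by simp
    qed
    show "(sZ c w, c * r) \<in> G" if "(w, r) \<in> G" for c w r
      using that scale unfolding G_def by blast
    show "norm r \<le> norm w" if "(w, r) \<in> G" for w r
      using that norm_eval_sum_le[OF fg] unfolding G_def by blast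
  qed blast
  show thesis
    using that[OF h(1)] h(2) G[of "[(_, _)]"] by simp
qed

lemma
  assumes "f \<in> dual_ball sX" "g \<in> dual_ball sY"
  shows tensor_functional_dual_ball: "tensor_functional f g \<in> dual_ball sZ"
    and tensor_functional_tensor_sum: "tensor_functional f g (tensor_sum ps) = eval_sum f g ps"
proof -
  obtain h where h: "h \<in> dual_ball sZ" "\<And>x y. h (tens x y) = f x * g y"
    using exists_tensor_functional[OF assms] by blast
  have hs: "h \<in> dual_space sZ"
    using h(1) by (simp add: dual_ball_def)
  have "tensor_functional f g = h"
    unfolding tensor_functional_def
  proof (rule the_equality)
    show "h \<in> dual_space sZ \<and> (\<forall>x y. h (tens x y) = f x * g y)"
      using hs h(2) by simp
    show "k = h" if "k \<in> dual_space sZ \<and> (\<forall>x y. k (tens x y) = f x * g y)" for k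
    proof (rule dual_space_eq_if_eq_on_tensors)
      show "k \<in> dual_space sZ" and "k (tens x y) = f x * g y" for x y
        using that by simp_all
    qed (use hs h(2) in simp_all)
  qed
  then show "tensor_functional f g \<in> dual_ball sZ"
    and "tensor_functional f g (tensor_sum ps) = eval_sum f g ps"
    using h(1) dual_space_eq_on_tensor_sums[OF hs h(2)] by simp_all
qed

text \<open>The error is split in three: approximating \<open>z\<close> by a tensor sum, almost
  attaining the injective norm of that sum, and passing back to \<open>z\<close> with the
  functional.\<close>

lemma norming_set_dual_ball_tensors: "norming_set sZ dual_ball_tensors"
proof unfold_locales
  show "dual_ball_tensors \<subseteq> dual_ball sZ"
    using tensor_functional_dual_ball by (auto simp: dual_ball_tensors_def)
next
  fix e :: real and z assume e: "e > 0"
  have "z \<in> closure (range tensor_sum)"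
    by (simp add: dense_tensors)
  then obtain ps where ps: "dist (tensor_sum ps) z < e / 3"
    using e unfolding closure_approachable by (metis divide_pos_pos rangeE zero_less_numeral)
  obtain f g where fg: "f \<in> dual_ball sX" "g \<in> dual_ball sY"
    and attained: "norm (tensor_sum ps) - e / 3 < norm (eval_sum f g ps)"
    using tensor_sum_approximately_attained[of "e / 3"] e by auto
  obtain c where c: "norm c = 1" "c * eval_sum f g ps = of_real (norm (eval_sum f g ps))"
    using unimodular_rotation by blast
  \<comment> \<open>The rotation stays inside the dual ball of \<open>X\<close> and turns the
    modulus of the evaluated sum into a real part.\<close>
  define f' where "f' x = c * f x" for x
  have f': "f' \<in> dual_ball sX"
    unfolding f'_def by (rule dual_ball_mult[OF fg(1)]) (simp add: c)
  define h where "h = tensor_functional f' g"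
  have h: "h \<in> dual_ball sZ"
    unfolding h_def by (rule tensor_functional_dual_ball[OF f' fg(2)])
  have "eval_sum f' g ps = c * eval_sum f g ps"
    by (induction ps) (auto simp: f'_def algebra_simps)
  then have "re (h (tensor_sum ps)) = norm (eval_sum f g ps)"
    using c(2) tensor_functional_tensor_sum[OF f' fg(2)] by (simp add: h_def)
  then have "norm (eval_sum f g ps) = re (h z) + re (h (tensor_sum ps - z))"
    using dual_ball_add[OF h, of z "tensor_sum ps - z"] by (simp add: re_add)
  also have "re (h (tensor_sum ps - z)) < e / 3"
    using re_le_norm[of "h (tensor_sum ps - z)"] dual_ball_norm_le[OF h, of "tensor_sum ps - z"] ps
    by (simp add: dist_norm)
  finally have "norm (eval_sum f g ps) < re (h z) + e / 3"
    by simp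
  moreover have "norm z \<le> norm (tensor_sum ps) + dist (tensor_sum ps) z"
    by (metis dist_norm dist_commute norm_triangle_sub)
  ultimately have "norm z - e < re (h z)"
    using attained ps by simp
  moreover have "h \<in> dual_ball_tensors"
    using f' fg(2) by (auto simp: dual_ball_tensors_def h_def)
  ultimately show "\<exists>h\<in>dual_ball_tensors. norm z - e < re (h z)"
    by blast
qed

text \<open>Norming functionals of the factors bound the norm of the tensor from below. This makes
  \<open>Z\<close> non-zero when both factors are.\<close>

lemma tens_nonzero:
  assumes "x \<noteq> 0" "y \<noteq> 0"
  shows "tens x y \<noteq> 0"
proof -
  obtain f where f: "f \<in> dual_ball sX" "f x = of_real (norm x)"
    using X.exists_norming_functional by blast
  obtain g where g: "g \<in> dual_ball sY" "g y = of_real (norm y)"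
    using Y.exists_norming_functional by blast
  have "norm x * norm y \<le> norm (tens x y)"
    using norm_eval_sum_le[OF f(1) g(1), of "[(x, y)]"] f(2) g(2) by (simp add: norm_mult)
  then show ?thesis
    using assms by (auto simp: mult_le_0_iff)
qed

lemma limit_set_eq: "limit_set u z = limit_values dual_ball_tensors u z"
  by (simp add: limit_set_def limit_values_def)

end

text \<open>Non-zero factors are required for smoothness because \<open>Z\<close> vanishes as soon
  as one factor does; then no functional has norm 1, although each limit set is the singleton of
  0.\<close>

theorem proposition3p8:
  fixes sX :: "'k::real_or_complex_field \<Rightarrow> 'a::banach \<Rightarrow> 'a"
    and sY :: "'k \<Rightarrow> 'b::banach \<Rightarrow> 'b"
    and sZ :: "'k \<Rightarrow> 'c::banach \<Rightarrow> 'c"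
    and tens :: "'a \<Rightarrow> 'b \<Rightarrow> 'c"
  assumes "injective_tensor_product sX sY sZ tens"
  shows "(\<forall>u z. bj_orthogonal sZ u z \<longleftrightarrow>
            0 \<in> convex hull (injective_tensor_product.limit_set sX sY sZ tens u z)) \<and>
         ((\<exists>x::'a. x \<noteq> 0) \<and> (\<exists>y::'b. y \<noteq> 0) \<longrightarrow>
            (\<forall>u. smooth_point sZ u \<longleftrightarrow>
              (\<forall>z. is_singleton (injective_tensor_product.limit_set sX sY sZ tens u z))))"
proof -
  interpret injective_tensor_product sX sY sZ tens
    by (rule assms)
  interpret D: norming_set sZ dual_ball_tensors
    by (rule norming_set_dual_ball_tensors)
  show ?thesis
    unfolding limit_set_eq
  proof (intro conjI allI impI)
    show "bj_orthogonal sZ u z \<longleftrightarrow> 0 \<in> convex hull limit_values dual_ball_tensors u z" for u z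
      by (rule D.bj_orthogonal_iff)
    assume "(\<exists>x::'a. x \<noteq> 0) \<and> (\<exists>y::'b. y \<noteq> 0)"
    then obtain x :: 'a and y :: 'b where "x \<noteq> 0" "y \<noteq> 0"
      by blast
    then have "tens x y \<noteq> 0"
      by (rule tens_nonzero)
    then have "\<exists>z::'c. z \<noteq> 0"
      by (rule exI)
    then show "smooth_point sZ u \<longleftrightarrow> (\<forall>z. is_singleton (limit_values dual_ball_tensors u z))" for u
      by (rule D.smooth_point_iff)
  qed
qed

end
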